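(* Fix $\theta\in\Omega$ and assume that the weighted Fermat–Torricelli point $a_{\mathrm{wFT}}$ does not coincide with $x^{(j)}$ for $j=1,2,3$. If the triple junction $a$, the point $a_{\mathrm{wFT}}$, and the circumcenter $a_{\mathrm{cc}}$ are all the same, then, writing $\sigma_j=\sigma(\theta_j)$, $$\frac{(\sigma_1+\sigma_2)^2-\sigma_3^2}{2\sigma_1\sigma_2|x^{(1)}-x^{(2)}|^2}=\frac{(\sigma_2+\sigma_3)^2-\sigma_1^2}{2\sigma_2\sigma_3|x^{(2)}-x^{(3)}|^2}=\frac{(\sigma_3+\sigma_1)^2-\sigma_2^2}{2\sigma_3\sigma_1|x^{(3)}-x^{(1)}|^2}.$$
   Context: $\theta=(\theta_1,\theta_2,\theta_3)\in\Omega=\{\theta\in(-\frac{\pi}{4},\frac{\pi}{4})^3:\theta_1+\theta_2+\theta_3=0\}$ are the misorientations. $\sigma:\mathbb{R}\to\mathbb{R}$ is a $C^1$ function (surface tension), with $\sigma(\theta_j)>0$ for $j=1,2,3$. $x^{(1)},x^{(2)},x^{(3)}\in\mathbb{R}^2$ are fixed non-collinear points (so that a circumcircle exists), $\Omega_{\mathrm{TJ}}\subset\mathbb{R}^2$ is a bounded domain (open connected set), and $E(\theta,a)=\sum_{j=1}^3\sigma(\theta_j)|a-x^{(j)}|$. The weighted Fermat–Torricelli point $a_{\mathrm{wFT}}\in\Omega_{\mathrm{TJ}}$ is the minimizer of $a\mapsto E(\theta,a)$ over $\Omega_{\mathrm{TJ}}$, which is taken to exist. The circumcenter $a_{\mathrm{cc}}$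 is the point with $|a_{\mathrm{cc}}-x^{(1)}|=|a_{\mathrm{cc}}-x^{(2)}|=|a_{\mathrm{cc}}-x^{(3)}|$. The triple junction is a point $a\in\Omega_{\mathrm{TJ}}$. *)

theory Defs
  imports "HOL-Analysis.Analysis"
begin

definition misorientations :: "(real ^ 3) set" where
  "misorientations =
     {\<theta>. (\<forall>j. \<theta> $ j \<in> {- pi / 4 <..< pi / 4}) \<and> \<theta> $ 1 + \<theta> $ 2 + \<theta> $ 3 = 0}"

definition energy ::
  "(real \<Rightarrow> real) \<Rightarrow> (3 \<Rightarrow> real ^ 2) \<Rightarrow> real ^ 3 \<Rightarrow> real ^ 2 \<Rightarrow> real" where
  "energy \<sigma> x \<theta> a = (\<Sum>j\<in>UNIV. \<sigma> (\<theta> $ j) * norm (a - x j))"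

text \<open>The minimization is over the prescribed domain \<open>D\<close>, not over the whole plane.
  The weighted Fermat--Torricelli point and the circumcenter are given as predicates on
  points, so that no value is assigned to them when they fail to exist.\<close>

definition is_wFT_point ::
  "(real \<Rightarrow> real) \<Rightarrow> (3 \<Rightarrow> real ^ 2) \<Rightarrow> (real ^ 2) set \<Rightarrow> real ^ 3 \<Rightarrow> real ^ 2 \<Rightarrow> bool" where
  "is_wFT_point \<sigma> x D \<theta> a \<longleftrightarrow> is_arg_min (energy \<sigma> x \<theta>) (\<lambda>b. b \<in> D) a"

definition is_circumcenter :: "(3 \<Rightarrow> real ^ 2) \<Rightarrow> real ^ 2 \<Rightarrow> bool" where
  "is_circumcenter x a \<longleftrightarrow>
     norm (a - x 1) = norm (a - x 2) \<and> norm (a - x 2) = norm (a - x 3)"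

end

theory Submission
  imports Defs
begin

text \<open>At an interior minimizer of \<open>E\<close> off the vertices the forces
  \<open>\<sigma>\<^sub>j (a - x\<^sub>j) / |a - x\<^sub>j|\<close> balance. At the circumcenter all \<open>|a - x\<^sub>j|\<close> equal the
  circumradius \<open>R\<close>, so \<open>|\<sigma>\<^sub>1 (a - x\<^sub>1) + \<sigma>\<^sub>2 (a - x\<^sub>2)| = \<sigma>\<^sub>3 R\<close>. Squaring and
  polarizing shows that each of the three quotients equals \<open>1 / (2 R\<^sup>2)\<close>.\<close>

text \<open>Off its centre \<open>x j\<close>, the distance \<open>norm (b - x j)\<close> is
  differentiable with gradient \<open>sgn (b - x j)\<close>. A minimizer over an open set is a
  critical point, so the weighted gradients cancel.\<close>

lemma weighted_distance_sum_minimizer_balance: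
  fixes x :: "'i \<Rightarrow> 'a::real_inner" and w :: "'i \<Rightarrow> real"
  assumes "open D" "a \<in> D"
    and min: "\<And>b. b \<in> D \<Longrightarrow> (\<Sum>j\<in>I. w j * norm (a - x j)) \<le> (\<Sum>j\<in>I. w j * norm (b - x j))"
    and ne: "\<And>j. j \<in> I \<Longrightarrow> a \<noteq> x j"
  shows "(\<Sum>j\<in>I. w j *\<^sub>R sgn (a - x j)) = 0"
proof -
  let ?g = "\<Sum>j\<in>I. w j *\<^sub>R sgn (a - x j)"
  have d: "((\<lambda>b. norm (b - x j)) has_derivative (\<lambda>h. h \<bullet> sgn (a - x j))) (at a)" if "j \<in> I" for j
    using has_derivative_compose[OF has_derivative_diff[OF has_derivative_ident has_derivative_const]
        has_derivative_norm[of "a - x j"]] ne[OF that]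
    by simp
  have "((\<lambda>b. \<Sum>j\<in>I. w j * norm (b - x j)) has_derivative (\<lambda>h. \<Sum>j\<in>I. w j * (h \<bullet> sgn (a - x j)))) (at a)"
    by (intro has_derivative_sum has_derivative_mult_right d)
  then have "(\<lambda>h. \<Sum>j\<in>I. w j * (h \<bullet> sgn (a - x j))) = (\<lambda>h. 0)"
    using differential_zero_maxmin[OF \<open>a \<in> D\<close> \<open>open D\<close>] min by blast
  then have "(\<Sum>j\<in>I. w j * (h \<bullet> sgn (a - x j))) = 0" for h
    by meson
  moreover have "h \<bullet> ?g = (\<Sum>j\<in>I. w j * (h \<bullet> sgn (a - x j)))" for h
    by (simp add: inner_sum_right)
  \<comment> \<open>The derivative vanishes in every direction; the direction \<open>h = ?g\<close>
    turns it into the squared norm of the gradient.\<close>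
  ultimately have "?g \<bullet> ?g = 0"
    by metis
  then show ?thesis
    by simp
qed

text \<open>Treats one pair of vertices. The value \<open>1 / (2 * R\<^sup>2)\<close> depends on
  neither the pair nor the weights, so cyclic relabelling gives the whole chain of
  equalities.\<close>

lemma cosphere_balance_quotient:
  fixes x y z a :: "'a::real_inner"
  assumes balance: "p *\<^sub>R (a - x) + q *\<^sub>R (a - y) + r *\<^sub>R (a - z) = 0"
    and R: "norm (a - x) = R" "norm (a - y) = R" "norm (a - z) = R"
    and pos: "p > 0" "q > 0" "R > 0"
    and "x \<noteq> y"
  shows "((p + q)\<^sup>2 - r\<^sup>2) / (2 * p * q * (norm (x - y))\<^sup>2) = 1 / (2 * R\<^sup>2)"
proof -
  define u v where uv: "u = a - x" "v = a - y"
  have n: "u \<bullet> u = R\<^sup>2" "v \<bullet> v = R\<^sup>2"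
    using R by (simp_all add: uv flip: power2_norm_eq_inner)
  have "p *\<^sub>R u + q *\<^sub>R v = - (r *\<^sub>R (a - z))"
    using balance by (simp add: uv eq_neg_iff_add_eq_0)
  then have "(norm (p *\<^sub>R u + q *\<^sub>R v))\<^sup>2 = r\<^sup>2 * R\<^sup>2"
    using R by (simp add: power_mult_distrib)
  then have 1: "p\<^sup>2 * R\<^sup>2 + q\<^sup>2 * R\<^sup>2 + 2 * p * q * (u \<bullet> v) = r\<^sup>2 * R\<^sup>2"
    by (simp add: power2_norm_eq_inner inner_add inner_commute[of v u] n
        power2_eq_square[of p] power2_eq_square[of q] algebra_simps)
  have "(norm (x - y))\<^sup>2 = (v - u) \<bullet> (v - u)"
    by (simp add: uv power2_norm_eq_inner)
  then have 2: "(norm (x - y))\<^sup>2 = 2 * R\<^sup>2 - 2 * (u \<bullet> v)"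
    by (simp add: inner_diff inner_commute[of v u] n)
  \<comment> \<open>Eliminates \<open>u \<bullet> v\<close> between the squared balance
    \<open>1\<close> and the law of cosines \<open>2\<close>; the term
    \<open>2 * p * q * R\<^sup>2\<close> completes the square
    \<open>(p + q)\<^sup>2\<close>.\<close>
  have "((p + q)\<^sup>2 - r\<^sup>2) * R\<^sup>2 = p * q * (norm (x - y))\<^sup>2"
    using 1 unfolding 2 by (simp add: power2_sum algebra_simps)
  then show ?thesis
    using pos \<open>x \<noteq> y\<close> by (simp add: divide_simps)
qed

theorem corollary4p12:
  fixes \<sigma> :: "real \<Rightarrow> real"
    and \<theta> :: "real ^ 3"
    and x :: "3 \<Rightarrow> real ^ 2"
    and \<Omega>\<^sub>T\<^sub>J :: "(real ^ 2) set"
    and a a_wFT a_cc :: "real ^ 2"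
  assumes sigma_C1: "\<sigma> C1_differentiable_on UNIV"
    and theta: "\<theta> \<in> misorientations"
    and sigma_pos: "\<And>j. \<sigma> (\<theta> $ j) > 0"
    and noncollinear: "\<not> collinear {x 1, x 2, x 3}"
    and domain: "open \<Omega>\<^sub>T\<^sub>J" "connected \<Omega>\<^sub>T\<^sub>J" "bounded \<Omega>\<^sub>T\<^sub>J"
    and junction: "a \<in> \<Omega>\<^sub>T\<^sub>J"
    and wFT: "is_wFT_point \<sigma> x \<Omega>\<^sub>T\<^sub>J \<theta> a_wFT"
    and wFT_not_vertex: "\<And>j. a_wFT \<noteq> x j"
    and cc: "is_circumcenter x a_cc"
    and coincide: "a = a_wFT" "a_wFT = a_cc"
  shows "((\<sigma> (\<theta> $ 1) + \<sigma> (\<theta> $ 2))\<^sup>2 - (\<sigma> (\<theta> $ 3))\<^sup>2)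
           / (2 * \<sigma> (\<theta> $ 1) * \<sigma> (\<theta> $ 2) * (norm (x 1 - x 2))\<^sup>2)
         = ((\<sigma> (\<theta> $ 2) + \<sigma> (\<theta> $ 3))\<^sup>2 - (\<sigma> (\<theta> $ 1))\<^sup>2)
           / (2 * \<sigma> (\<theta> $ 2) * \<sigma> (\<theta> $ 3) * (norm (x 2 - x 3))\<^sup>2)
       \<and> ((\<sigma> (\<theta> $ 2) + \<sigma> (\<theta> $ 3))\<^sup>2 - (\<sigma> (\<theta> $ 1))\<^sup>2)
           / (2 * \<sigma> (\<theta> $ 2) * \<sigma> (\<theta> $ 3) * (norm (x 2 - x 3))\<^sup>2)
         = ((\<sigma> (\<theta> $ 3) + \<sigma> (\<theta> $ 1))\<^sup>2 - (\<sigma> (\<theta> $ 2))\<^sup>2)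
           / (2 * \<sigma> (\<theta> $ 3) * \<sigma> (\<theta> $ 1) * (norm (x 3 - x 1))\<^sup>2)"
proof -
  let ?s = "\<lambda>j. \<sigma> (\<theta> $ j)"
  define R where "R = norm (a - x 1)"
  have R: "norm (a - x 1) = R" "norm (a - x 2) = R" "norm (a - x 3) = R"
    using cc coincide by (simp_all add: is_circumcenter_def R_def)
  have "R > 0"
    using wFT_not_vertex[of 1] coincide by (simp add: R_def)
  have "energy \<sigma> x \<theta> a \<le> energy \<sigma> x \<theta> b" if "b \<in> \<Omega>\<^sub>T\<^sub>J" for b
    using wFT that coincide by (auto simp: is_wFT_point_def is_arg_min_linorder)
  then have "(\<Sum>j\<in>UNIV. ?s j *\<^sub>R sgn (a - x j)) = 0"
    using weighted_distance_sum_minimizer_balance[of \<Omega>\<^sub>T\<^sub>J a ?s x UNIV] domain junction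
      wFT_not_vertex coincide
    by (simp add: energy_def)
  \<comment> \<open>Here the circumcenter enters: all three unit vectors have the same normalizing
    factor \<open>inverse R\<close>, which can be pulled out of the sum.\<close>
  then have "inverse R *\<^sub>R (?s 1 *\<^sub>R (a - x 1) + ?s 2 *\<^sub>R (a - x 2) + ?s 3 *\<^sub>R (a - x 3)) = 0"
    by (simp add: sum_3 sgn_div_norm R scaleR_add_right mult.commute)
  then have balance: "?s 1 *\<^sub>R (a - x 1) + ?s 2 *\<^sub>R (a - x 2) + ?s 3 *\<^sub>R (a - x 3) = 0"
    using \<open>R > 0\<close> by simp
  \<comment> \<open>If two vertices coincided, at most two distinct points would remain, and these
    are always collinear.\<close>
  have "x 1 \<noteq> x 2" "x 2 \<noteq> x 3" "x 3 \<noteq> x 1"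
    using noncollinear by (auto simp: insert_commute)
  \<comment> \<open>The three cyclic instances have rotated forms of the same balance equation as
    premise, matched by \<open>add_ac\<close>.\<close>
  then show ?thesis
    using cosphere_balance_quotient[of "?s 1" a "x 1" "?s 2" "x 2" "?s 3" "x 3" R]
      cosphere_balance_quotient[of "?s 2" a "x 2" "?s 3" "x 3" "?s 1" "x 1" R]
      cosphere_balance_quotient[of "?s 3" a "x 3" "?s 1" "x 1" "?s 2" "x 2" R]
      balance R \<open>R > 0\<close> sigma_pos
    by (simp add: add_ac)
qed

end
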